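(* Let $\mathbb{K}$ be a field and $n\geq 1$ an integer. The algebra $\mathbb{K}[[x_1,\dots,x_n]]$ of formal power series in $n$ commuting indeterminates is not finitely generated as a $\mathbb{K}$-algebra. *)

theory Defs
  imports "HOL-Algebra.Algebra"
begin

text \<open>A monomial \<open>x\<^sub>0 ^ a 0 * \<dots> * x\<^sub>n\<^sub>-\<^sub>1 ^ a (n - 1)\<close> is encoded by its exponent vector \<open>a\<close>,
  continued by \<open>0\<close> outside \<open>{..<n}\<close>.\<close>

definition exponents :: "nat \<Rightarrow> (nat \<Rightarrow> nat) set" where
  "exponents n = {a. \<forall>i\<ge>n. a i = 0}"

text \<open>A power series over \<open>K\<close> is the family of its coefficients. The order and the subtraction on
  exponent vectors are pointwise, so the multiplication below is the Cauchy product
  \<open>(f g)\<^sub>m = (\<Sum>a + b = m. f\<^sub>a g\<^sub>b)\<close>.\<close>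

definition power_series_algebra ::
  "('a, 'b) ring_scheme \<Rightarrow> nat \<Rightarrow> ('a, (nat \<Rightarrow> nat) \<Rightarrow> 'a) module" where
  "power_series_algebra K n =
    \<lparr>carrier = exponents n \<rightarrow>\<^sub>E carrier K,
     monoid.mult = (\<lambda>f g. \<lambda>m\<in>exponents n. \<Oplus>\<^bsub>K\<^esub>a\<in>{a. a \<le> m}. f a \<otimes>\<^bsub>K\<^esub> g (m - a)),
     one = (\<lambda>m\<in>exponents n. if m = (\<lambda>_. 0) then \<one>\<^bsub>K\<^esub> else \<zero>\<^bsub>K\<^esub>),
     ring.zero = (\<lambda>m\<in>exponents n. \<zero>\<^bsub>K\<^esub>),
     ring.add = (\<lambda>f g. \<lambda>m\<in>exponents n. f m \<oplus>\<^bsub>K\<^esub> g m),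
     module.smult = (\<lambda>c f. \<lambda>m\<in>exponents n. c \<otimes>\<^bsub>K\<^esub> f m)\<rparr>"

text \<open>The predicate \<open>subalgebra\<close> of the library does not require closure under
  multiplication; a subalgebra here is a unital subring that is also a submodule.\<close>

definition generated_subalgebra ::
  "('a, 'm) ring_scheme \<Rightarrow> ('a, 'b, 'n) module_scheme \<Rightarrow> 'b set \<Rightarrow> 'b set" where
  "generated_subalgebra K A S = \<Inter>{B. subring B A \<and> submodule B K A \<and> S \<subseteq> B}"

definition finitely_generated_algebra ::
  "('a, 'm) ring_scheme \<Rightarrow> ('a, 'b, 'n) module_scheme \<Rightarrow> bool" where
  "finitely_generated_algebra K A \<longleftrightarrow>
    (\<exists>S. finite S \<and> S \<subseteq> carrier A \<and> generated_subalgebra K A S = carrier A)"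


subsection \<open>Power series form a commutative algebra\<close>

lemma exponents_le:
  assumes "m \<in> exponents n" "a \<le> m"
  shows "a \<in> exponents n"
proof -
  have "a i = 0" if "i \<ge> n" for i
    using le_funD[OF assms(2), of i] assms(1) that by (simp add: exponents_def)
  then show ?thesis by (simp add: exponents_def)
qed

lemma exponents_diff: "m \<in> exponents n \<Longrightarrow> m - a \<in> exponents n"
  unfolding exponents_def by simp

lemma zero_in_exponents: "(\<lambda>_. 0) \<in> exponents n"
  unfolding exponents_def by simp

lemma finite_exponents_le:
  assumes "m \<in> exponents n"
  shows "finite {a. a \<le> m}"
proof (rule finite_subset)
  show "{a. a \<le> m} \<subseteq> (\<lambda>g i. if i < n then g i else 0) ` (\<Pi>\<^sub>E i\<in>{..<n}. {..m i})"
  proof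
    fix a assume "a \<in> {a. a \<le> m}"
    then have le: "\<And>i. a i \<le> m i"
      by (simp add: le_fun_def)
    then have "a i = 0" if "i \<ge> n" for i
      using that assms le[of i] by (simp add: exponents_def)
    then have "a = (\<lambda>i. if i < n then (restrict a {..<n}) i else 0)"
      by (auto simp: fun_eq_iff)
    moreover have "restrict a {..<n} \<in> (\<Pi>\<^sub>E i\<in>{..<n}. {..m i})"
      using le by auto
    ultimately show "a \<in> (\<lambda>g i. if i < n then g i else 0) ` (\<Pi>\<^sub>E i\<in>{..<n}. {..m i})"
      by blast
  qed
qed (auto intro!: finite_PiE)

lemma (in abelian_monoid) finsum_Sigma:
  assumes "finite A" "\<And>a. a \<in> A \<Longrightarrow> finite (B a)"
    and cl: "\<And>a b. a \<in> A \<Longrightarrow> b \<in> B a \<Longrightarrow> f a b \<in> carrier G"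
  shows "(\<Oplus>a\<in>A. \<Oplus>b\<in>B a. f a b) = (\<Oplus>p\<in>Sigma A B. f (fst p) (snd p))"
proof -
  have "(\<Oplus>p\<in>Sigma A B. f (fst p) (snd p)) = (\<Oplus>p\<in>(\<Union>a\<in>A. Pair a ` B a). f (fst p) (snd p))"
    by (rule arg_cong[where f = "finsum G _"]) auto
  also have "\<dots> = (\<Oplus>a\<in>A. \<Oplus>p\<in>Pair a ` B a. f (fst p) (snd p))"
    by (rule add.finprod_UN_disjoint) (use assms in \<open>auto simp: pairwise_def disjnt_def\<close>)
  also have "\<dots> = (\<Oplus>a\<in>A. \<Oplus>b\<in>B a. f a b)"
  proof (rule finsum_cong')
    fix a assume a: "a \<in> A"
    show "(\<Oplus>p\<in>Pair a ` B a. f (fst p) (snd p)) = (\<Oplus>b\<in>B a. f a b)"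
      by (subst finsum_reindex) (use a cl in \<open>auto simp: inj_on_def\<close>)
  qed (use cl in \<open>auto intro!: finsum_closed\<close>)
  finally show ?thesis by simp
qed

context cring
begin

lemma power_series_coeff:
  "f \<in> exponents n \<rightarrow>\<^sub>E carrier R \<Longrightarrow> m \<in> exponents n \<Longrightarrow> f m \<in> carrier R"
  by auto

lemma power_series_prod_closed:
  assumes "f \<in> exponents n \<rightarrow>\<^sub>E carrier R" "g \<in> exponents n \<rightarrow>\<^sub>E carrier R" "m \<in> exponents n" "a \<le> m"
  shows "f a \<otimes> g (m - a) \<in> carrier R"
  by (intro m_closed power_series_coeff[OF assms(1)] power_series_coeff[OF assms(2)]
      exponents_le[OF assms(3,4)] exponents_diff[OF assms(3)])

lemma power_series_conv_closed:
  assumes "f \<in> exponents n \<rightarrow>\<^sub>E carrier R" "g \<in> exponents n \<rightarrow>\<^sub>E carrier R" "m \<in> exponents n"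
  shows "(\<Oplus>a\<in>{a. a \<le> m}. f a \<otimes> g (m - a)) \<in> carrier R"
  using power_series_prod_closed[OF assms] by (intro finsum_closed) auto

lemma power_series_conv_comm:
  assumes "f \<in> exponents n \<rightarrow>\<^sub>E carrier R" "g \<in> exponents n \<rightarrow>\<^sub>E carrier R" "m \<in> exponents n"
  shows "(\<Oplus>a\<in>{a. a \<le> m}. f a \<otimes> g (m - a)) = (\<Oplus>a\<in>{a. a \<le> m}. g a \<otimes> f (m - a))"
proof -
  have inv: "m - (m - a) = a" if "a \<le> m" for a
    using that by (auto simp: fun_eq_iff le_fun_def)
  have le: "m - a \<le> m" for a
    by (auto simp: le_fun_def)
  have img: "(\<lambda>a. m - a) ` {a. a \<le> m} = {a. a \<le> m}"
  proof (intro equalityI subsetI)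
    fix a assume "a \<in> {a. a \<le> m}"
    then have "a = m - (m - a)" "m - a \<in> {a. a \<le> m}" using inv le by auto
    then show "a \<in> (\<lambda>a. m - a) ` {a. a \<le> m}" by (rule image_eqI)
  qed (use le in auto)
  have inj: "inj_on (\<lambda>a. m - a) {a. a \<le> m}"
    by (rule inj_onI) (metis inv mem_Collect_eq)
  have "(\<Oplus>a\<in>{a. a \<le> m}. f a \<otimes> g (m - a)) = (\<Oplus>a\<in>(\<lambda>a. m - a) ` {a. a \<le> m}. f a \<otimes> g (m - a))"
    by (simp only: img)
  also have "\<dots> = (\<Oplus>a\<in>{a. a \<le> m}. f (m - a) \<otimes> g (m - (m - a)))"
    by (rule finsum_reindex[OF _ inj]) (use power_series_prod_closed[OF assms] img in auto)
  also have "\<dots> = (\<Oplus>a\<in>{a. a \<le> m}. g a \<otimes> f (m - a))"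
  proof (rule finsum_cong')
    fix a assume "a \<in> {a. a \<le> m}"
    then have a: "a \<le> m" by simp
    show "f (m - a) \<otimes> g (m - (m - a)) = g a \<otimes> f (m - a)"
      unfolding inv[OF a]
      by (intro m_comm power_series_coeff[OF assms(1)] power_series_coeff[OF assms(2)]
          exponents_diff exponents_le[OF _ a] assms)
  qed (use power_series_prod_closed[OF assms(2,1,3)] in auto)
  finally show ?thesis .
qed

lemma power_series_conv_assoc:
  assumes f: "f \<in> exponents n \<rightarrow>\<^sub>E carrier R" and g: "g \<in> exponents n \<rightarrow>\<^sub>E carrier R"
    and h: "h \<in> exponents n \<rightarrow>\<^sub>E carrier R" and m: "m \<in> exponents n"
  shows "(\<Oplus>a\<in>{a. a \<le> m}. (\<Oplus>b\<in>{b. b \<le> a}. f b \<otimes> g (a - b)) \<otimes> h (m - a)) =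
    (\<Oplus>b\<in>{b. b \<le> m}. f b \<otimes> (\<Oplus>c\<in>{c. c \<le> m - b}. g c \<otimes> h (m - b - c)))"
proof -
  note cl = power_series_coeff[OF f] power_series_coeff[OF g] power_series_coeff[OF h]
  let ?L = "SIGMA a : {a. a \<le> m}. {b. b \<le> a}"
  let ?R = "SIGMA b : {b. b \<le> m}. {c. c \<le> m - b}"
  let ?h = "\<lambda>(b, c). (\<lambda>i. b i + c i, b) :: (nat \<Rightarrow> nat) \<times> (nat \<Rightarrow> nat)"
  let ?t = "\<lambda>a b. f b \<otimes> g (a - b) \<otimes> h (m - a)"
  have ex: "a \<in> exponents n" if "a \<le> m" for a
    by (rule exponents_le[OF m that])
  have ex2: "b \<in> exponents n" if "b \<le> a" "a \<le> m" for a b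
    using exponents_le ex that by blast
  have t: "?t a b \<in> carrier R" if "a \<le> m" "b \<le> a" for a b
    by (intro m_closed cl exponents_diff m ex[OF that(1)] ex2[OF that(2,1)])
  have img: "?h ` ?R = ?L"
  proof (intro equalityI subsetI)
    fix p assume "p \<in> ?h ` ?R"
    then show "p \<in> ?L" by (fastforce simp: le_fun_def le_diff_conv2 add.commute)
  next
    fix p assume p: "p \<in> ?L"
    obtain a b where ab: "p = (a, b)" by (cases p)
    with p have "b \<le> a" "a \<le> m" by auto
    then have "(b, a - b) \<in> ?R" "?h (b, a - b) = p"
      using ab by (auto simp: le_fun_def fun_eq_iff intro: order_trans diff_le_mono)
    then show "p \<in> ?h ` ?R" by (metis (no_types, lifting) imageI)
  qed
  have inj: "inj_on ?h ?R"
    by (auto simp: inj_on_def fun_eq_iff)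
  have "(\<Oplus>a\<in>{a. a \<le> m}. (\<Oplus>b\<in>{b. b \<le> a}. f b \<otimes> g (a - b)) \<otimes> h (m - a))
      = (\<Oplus>a\<in>{a. a \<le> m}. \<Oplus>b\<in>{b. b \<le> a}. ?t a b)"
  proof (rule finsum_cong')
    fix a assume "a \<in> {a. a \<le> m}"
    then have a: "a \<le> m" by simp
    show "(\<Oplus>b\<in>{b. b \<le> a}. f b \<otimes> g (a - b)) \<otimes> h (m - a) = (\<Oplus>b\<in>{b. b \<le> a}. ?t a b)"
      by (rule finsum_ldistr)
        (use power_series_prod_closed[OF f g ex[OF a]] finite_exponents_le[OF ex[OF a]]
          cl(3)[OF exponents_diff[OF m]] in auto)
  qed (use t in \<open>auto intro!: finsum_closed\<close>)
  also have "\<dots> = (\<Oplus>p\<in>?L. ?t (fst p) (snd p))"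
    by (rule finsum_Sigma) (use t finite_exponents_le[OF m] finite_exponents_le[OF ex] in auto)
  also have "\<dots> = (\<Oplus>p\<in>?h ` ?R. ?t (fst p) (snd p))"
    by (simp only: img)
  also have "\<dots> = (\<Oplus>p\<in>?R. ?t (fst (?h p)) (snd (?h p)))"
    by (rule finsum_reindex[OF _ inj], unfold img) (use t in auto)
  also have "\<dots> = (\<Oplus>p\<in>?R. f (fst p) \<otimes> (g (snd p) \<otimes> h (m - fst p - snd p)))"
  proof (rule finsum_cong')
    fix p assume p: "p \<in> ?R"
    obtain b c where bc: "p = (b, c)" by (cases p)
    with p have b: "b \<le> m" and c: "c \<le> m - b" by auto
    have "(\<lambda>i. b i + c i) - b = c" "m - (\<lambda>i. b i + c i) = m - b - c"
      by (auto simp: fun_eq_iff)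
    then show "?t (fst (?h p)) (snd (?h p)) = f (fst p) \<otimes> (g (snd p) \<otimes> h (m - fst p - snd p))"
      using bc by (simp add: m_assoc cl ex[OF b] exponents_le[OF exponents_diff[OF m] c]
          exponents_diff[OF exponents_diff[OF m]])
  next
    show "(\<lambda>p. f (fst p) \<otimes> (g (snd p) \<otimes> h (m - fst p - snd p))) \<in> ?R \<rightarrow> carrier R"
      by (auto intro!: m_closed cl exponents_diff m intro: ex exponents_le[OF exponents_diff[OF m]])
  qed simp
  also have "\<dots> = (\<Oplus>b\<in>{b. b \<le> m}. \<Oplus>c\<in>{c. c \<le> m - b}. f b \<otimes> (g c \<otimes> h (m - b - c)))"
    by (rule finsum_Sigma[symmetric])
      (auto intro!: m_closed cl exponents_diff m finite_exponents_le[of _ n]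
        intro: ex exponents_le[OF exponents_diff[OF m]])
  also have "\<dots> = (\<Oplus>b\<in>{b. b \<le> m}. f b \<otimes> (\<Oplus>c\<in>{c. c \<le> m - b}. g c \<otimes> h (m - b - c)))"
  proof (rule finsum_cong')
    fix b assume "b \<in> {b. b \<le> m}"
    then have b: "b \<le> m" by simp
    show "(\<Oplus>c\<in>{c. c \<le> m - b}. f b \<otimes> (g c \<otimes> h (m - b - c)))
        = f b \<otimes> (\<Oplus>c\<in>{c. c \<le> m - b}. g c \<otimes> h (m - b - c))"
      by (rule finsum_rdistr[symmetric])
        (use power_series_prod_closed[OF g h exponents_diff[OF m]] cl(1)[OF ex[OF b]]
          finite_exponents_le[OF exponents_diff[OF m]] in auto)
  next
    show "(\<lambda>b. f b \<otimes> (\<Oplus>c\<in>{c. c \<le> m - b}. g c \<otimes> h (m - b - c))) \<in> {b. b \<le> m} \<rightarrow> carrier R"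
      by (auto intro!: m_closed cl ex power_series_conv_closed[OF g h] exponents_diff m)
  qed simp
  finally show ?thesis .
qed

lemma power_series_conv_one:
  assumes f: "f \<in> exponents n \<rightarrow>\<^sub>E carrier R" and m: "m \<in> exponents n"
  shows "(\<Oplus>a\<in>{a. a \<le> m}. (if a = (\<lambda>_. 0) then \<one> else \<zero>) \<otimes> f (m - a)) = f m"
proof -
  have [simp]: "f (m - a) \<in> carrier R" for a
    by (rule power_series_coeff[OF f exponents_diff[OF m]])
  have "m - (\<lambda>_. 0) = m" by (auto simp: fun_eq_iff)
  have "(\<Oplus>a\<in>{a. a \<le> m}. (if a = (\<lambda>_. 0) then \<one> else \<zero>) \<otimes> f (m - a))
      = (\<Oplus>a\<in>{a. a \<le> m}. if (\<lambda>_. 0) = a then f (m - a) else \<zero>)"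
    by (rule finsum_cong') auto
  also have "\<dots> = f (m - (\<lambda>_. 0))"
    by (rule finsum_singleton) (use finite_exponents_le[OF m] in \<open>auto simp: le_fun_def\<close>)
  finally show ?thesis using \<open>m - (\<lambda>_. 0) = m\<close> by simp
qed

lemma power_series_cring: "cring (power_series_algebra R n)"
proof (rule cringI)
  show "abelian_group (power_series_algebra R n)"
  proof (rule abelian_groupI)
    show "\<zero>\<^bsub>power_series_algebra R n\<^esub> \<in> carrier (power_series_algebra R n)"
      by (simp add: power_series_algebra_def)
    fix f g assume "f \<in> carrier (power_series_algebra R n)" "g \<in> carrier (power_series_algebra R n)"
    then have f: "f \<in> exponents n \<rightarrow>\<^sub>E carrier R" and g: "g \<in> exponents n \<rightarrow>\<^sub>E carrier R"
      by (simp_all add: power_series_algebra_def)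
    note cl = power_series_coeff[OF f] power_series_coeff[OF g]
    show "f \<oplus>\<^bsub>power_series_algebra R n\<^esub> g \<in> carrier (power_series_algebra R n)"
      using cl by (simp add: power_series_algebra_def)
    show "f \<oplus>\<^bsub>power_series_algebra R n\<^esub> g = g \<oplus>\<^bsub>power_series_algebra R n\<^esub> f"
      using cl by (auto simp: power_series_algebra_def intro!: restrict_ext a_comm)
    fix h assume "h \<in> carrier (power_series_algebra R n)"
    then have h: "h \<in> exponents n \<rightarrow>\<^sub>E carrier R" by (simp add: power_series_algebra_def)
    show "f \<oplus>\<^bsub>power_series_algebra R n\<^esub> g \<oplus>\<^bsub>power_series_algebra R n\<^esub> h =
        f \<oplus>\<^bsub>power_series_algebra R n\<^esub> (g \<oplus>\<^bsub>power_series_algebra R n\<^esub> h)"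
      using cl power_series_coeff[OF h]
      by (auto simp: power_series_algebra_def intro!: restrict_ext a_assoc)
  next
    fix f assume "f \<in> carrier (power_series_algebra R n)"
    then have f: "f \<in> exponents n \<rightarrow>\<^sub>E carrier R" by (simp add: power_series_algebra_def)
    show "\<zero>\<^bsub>power_series_algebra R n\<^esub> \<oplus>\<^bsub>power_series_algebra R n\<^esub> f = f"
      unfolding power_series_algebra_def using f power_series_coeff[OF f]
      by (auto simp: PiE_iff intro!: extensionalityI[of _ "exponents n"])
    show "\<exists>g\<in>carrier (power_series_algebra R n).
        g \<oplus>\<^bsub>power_series_algebra R n\<^esub> f = \<zero>\<^bsub>power_series_algebra R n\<^esub>"
      by (rule bexI[of _ "\<lambda>m\<in>exponents n. \<ominus> f m"])
        (use power_series_coeff[OF f] in \<open>auto simp: power_series_algebra_def l_neg intro!: restrict_ext\<close>)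
  qed
  show "comm_monoid (power_series_algebra R n)"
  proof (rule comm_monoidI)
    show "\<one>\<^bsub>power_series_algebra R n\<^esub> \<in> carrier (power_series_algebra R n)"
      by (auto simp: power_series_algebra_def)
    fix f g assume "f \<in> carrier (power_series_algebra R n)" "g \<in> carrier (power_series_algebra R n)"
    then have f: "f \<in> exponents n \<rightarrow>\<^sub>E carrier R" and g: "g \<in> exponents n \<rightarrow>\<^sub>E carrier R"
      by (simp_all add: power_series_algebra_def)
    show "f \<otimes>\<^bsub>power_series_algebra R n\<^esub> g \<in> carrier (power_series_algebra R n)"
      using power_series_conv_closed[OF f g] by (auto simp: power_series_algebra_def)
    show "f \<otimes>\<^bsub>power_series_algebra R n\<^esub> g = g \<otimes>\<^bsub>power_series_algebra R n\<^esub> f"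
      using power_series_conv_comm[OF f g] by (auto simp: power_series_algebra_def)
    fix h assume "h \<in> carrier (power_series_algebra R n)"
    then have h: "h \<in> exponents n \<rightarrow>\<^sub>E carrier R" by (simp add: power_series_algebra_def)
    have "(\<Oplus>a\<in>{a. a \<le> m}. (\<lambda>m\<in>exponents n. \<Oplus>b\<in>{b. b \<le> m}. f b \<otimes> g (m - b)) a \<otimes> h (m - a))
        = (\<Oplus>a\<in>{a. a \<le> m}. f a \<otimes>
            (\<lambda>m\<in>exponents n. \<Oplus>b\<in>{b. b \<le> m}. g b \<otimes> h (m - b)) (m - a))"
      if m: "m \<in> exponents n" for m
    proof -
      have "(\<Oplus>a\<in>{a. a \<le> m}. (\<lambda>m\<in>exponents n. \<Oplus>b\<in>{b. b \<le> m}. f b \<otimes> g (m - b)) a \<otimes> h (m - a))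
          = (\<Oplus>a\<in>{a. a \<le> m}. (\<Oplus>b\<in>{b. b \<le> a}. f b \<otimes> g (a - b)) \<otimes> h (m - a))"
        by (rule finsum_cong')
          (use m in \<open>auto intro!: m_closed power_series_conv_closed[OF f g]
            power_series_coeff[OF h] exponents_diff simp: exponents_le\<close>)
      moreover have "(\<Oplus>a\<in>{a. a \<le> m}. f a \<otimes>
            (\<lambda>m\<in>exponents n. \<Oplus>b\<in>{b. b \<le> m}. g b \<otimes> h (m - b)) (m - a))
          = (\<Oplus>a\<in>{a. a \<le> m}. f a \<otimes> (\<Oplus>c\<in>{c. c \<le> m - a}. g c \<otimes> h (m - a - c)))"
        by (rule finsum_cong')
          (use m in \<open>auto intro!: m_closed power_series_conv_closed[OF g h]
            power_series_coeff[OF f] simp: exponents_diff exponents_le\<close>)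
      ultimately show ?thesis using power_series_conv_assoc[OF f g h m] by simp
    qed
    then show "f \<otimes>\<^bsub>power_series_algebra R n\<^esub> g \<otimes>\<^bsub>power_series_algebra R n\<^esub> h =
        f \<otimes>\<^bsub>power_series_algebra R n\<^esub> (g \<otimes>\<^bsub>power_series_algebra R n\<^esub> h)"
      unfolding power_series_algebra_def by (auto intro!: restrict_ext)
  next
    fix f assume "f \<in> carrier (power_series_algebra R n)"
    then have f: "f \<in> exponents n \<rightarrow>\<^sub>E carrier R" by (simp add: power_series_algebra_def)
    have "(\<Oplus>a\<in>{a. a \<le> m}. (\<lambda>m\<in>exponents n. if m = (\<lambda>_. 0) then \<one> else \<zero>) a \<otimes> f (m - a)) = f m"
      if m: "m \<in> exponents n" for m
    proof -
      have "(\<Oplus>a\<in>{a. a \<le> m}. (\<lambda>m\<in>exponents n. if m = (\<lambda>_. 0) then \<one> else \<zero>) a \<otimes> f (m - a))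
        = (\<Oplus>a\<in>{a. a \<le> m}. (if a = (\<lambda>_. 0) then \<one> else \<zero>) \<otimes> f (m - a))"
        by (rule finsum_cong')
          (use m in \<open>auto intro!: m_closed power_series_coeff[OF f] exponents_diff
            simp: exponents_le\<close>)
      then show ?thesis using power_series_conv_one[OF f m] by simp
    qed
    then show "\<one>\<^bsub>power_series_algebra R n\<^esub> \<otimes>\<^bsub>power_series_algebra R n\<^esub> f = f"
      using f unfolding power_series_algebra_def
      by (auto simp: PiE_iff intro!: extensionalityI[of _ "exponents n"])
  qed
  fix f g h assume "f \<in> carrier (power_series_algebra R n)" "g \<in> carrier (power_series_algebra R n)"
    "h \<in> carrier (power_series_algebra R n)"
  then have f: "f \<in> exponents n \<rightarrow>\<^sub>E carrier R" and g: "g \<in> exponents n \<rightarrow>\<^sub>E carrier R"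
    and h: "h \<in> exponents n \<rightarrow>\<^sub>E carrier R"
    by (simp_all add: power_series_algebra_def)
  have "(\<Oplus>a\<in>{a. a \<le> m}. (\<lambda>m\<in>exponents n. f m \<oplus> g m) a \<otimes> h (m - a))
      = (\<Oplus>a\<in>{a. a \<le> m}. f a \<otimes> h (m - a)) \<oplus> (\<Oplus>a\<in>{a. a \<le> m}. g a \<otimes> h (m - a))"
    if m: "m \<in> exponents n" for m
  proof -
    have "(\<Oplus>a\<in>{a. a \<le> m}. (\<lambda>m\<in>exponents n. f m \<oplus> g m) a \<otimes> h (m - a))
        = (\<Oplus>a\<in>{a. a \<le> m}. f a \<otimes> h (m - a) \<oplus> g a \<otimes> h (m - a))"
      by (rule finsum_cong')
        (use m in \<open>auto intro!: a_closed m_closed l_distr power_series_coeff[OF f]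
          power_series_coeff[OF g] power_series_coeff[OF h] exponents_diff simp: exponents_le\<close>)
    also have "\<dots> = (\<Oplus>a\<in>{a. a \<le> m}. f a \<otimes> h (m - a)) \<oplus> (\<Oplus>a\<in>{a. a \<le> m}. g a \<otimes> h (m - a))"
      by (rule finsum_addf)
        (use power_series_prod_closed[OF f h m] power_series_prod_closed[OF g h m] in auto)
    finally show ?thesis .
  qed
  then show "(f \<oplus>\<^bsub>power_series_algebra R n\<^esub> g) \<otimes>\<^bsub>power_series_algebra R n\<^esub> h =
      f \<otimes>\<^bsub>power_series_algebra R n\<^esub> h \<oplus>\<^bsub>power_series_algebra R n\<^esub> g \<otimes>\<^bsub>power_series_algebra R n\<^esub> h"
    unfolding power_series_algebra_def by (auto intro!: restrict_ext)
qed

lemma power_series_is_algebra: "algebra R (power_series_algebra R n)"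
proof (rule algebraI)
  show "cring R" ..
  show "cring (power_series_algebra R n)" by (rule power_series_cring)
  fix c f g assume c: "c \<in> carrier R"
    and "f \<in> carrier (power_series_algebra R n)" "g \<in> carrier (power_series_algebra R n)"
  then have f: "f \<in> exponents n \<rightarrow>\<^sub>E carrier R" and g: "g \<in> exponents n \<rightarrow>\<^sub>E carrier R"
    by (simp_all add: power_series_algebra_def)
  have "(\<Oplus>a\<in>{a. a \<le> m}. (\<lambda>m\<in>exponents n. c \<otimes> f m) a \<otimes> g (m - a))
      = c \<otimes> (\<Oplus>a\<in>{a. a \<le> m}. f a \<otimes> g (m - a))" if m: "m \<in> exponents n" for m
  proof -
    have "(\<Oplus>a\<in>{a. a \<le> m}. (\<lambda>m\<in>exponents n. c \<otimes> f m) a \<otimes> g (m - a))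
        = (\<Oplus>a\<in>{a. a \<le> m}. c \<otimes> (f a \<otimes> g (m - a)))"
      by (rule finsum_cong')
        (use m c in \<open>auto intro!: m_closed m_assoc power_series_coeff[OF f]
          power_series_coeff[OF g] exponents_diff simp: exponents_le\<close>)
    also have "\<dots> = c \<otimes> (\<Oplus>a\<in>{a. a \<le> m}. f a \<otimes> g (m - a))"
      by (rule finsum_rdistr[symmetric])
        (use c power_series_prod_closed[OF f g m] finite_exponents_le[OF m] in auto)
    finally show ?thesis .
  qed
  then show "(c \<odot>\<^bsub>power_series_algebra R n\<^esub> f) \<otimes>\<^bsub>power_series_algebra R n\<^esub> g =
      c \<odot>\<^bsub>power_series_algebra R n\<^esub> (f \<otimes>\<^bsub>power_series_algebra R n\<^esub> g)"
    unfolding power_series_algebra_def by (auto intro!: restrict_ext)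
next
  fix a f assume a: "a \<in> carrier R" and "f \<in> carrier (power_series_algebra R n)"
  then have f: "f \<in> exponents n \<rightarrow>\<^sub>E carrier R" by (simp add: power_series_algebra_def)
  note cl = a power_series_coeff[OF f]
  show "a \<odot>\<^bsub>power_series_algebra R n\<^esub> f \<in> carrier (power_series_algebra R n)"
    using cl by (simp add: power_series_algebra_def)
  {
    fix b assume b: "b \<in> carrier R"
    show "(a \<oplus> b) \<odot>\<^bsub>power_series_algebra R n\<^esub> f = a \<odot>\<^bsub>power_series_algebra R n\<^esub> f \<oplus>\<^bsub>power_series_algebra R n\<^esub> b \<odot>\<^bsub>power_series_algebra R n\<^esub> f"
      using cl b by (auto simp: power_series_algebra_def intro!: restrict_ext l_distr)
    show "a \<otimes> b \<odot>\<^bsub>power_series_algebra R n\<^esub> f = a \<odot>\<^bsub>power_series_algebra R n\<^esub> (b \<odot>\<^bsub>power_series_algebra R n\<^esub> f)"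
      using cl b by (auto simp: power_series_algebra_def intro!: restrict_ext m_assoc)
  }
  {
    fix g assume "g \<in> carrier (power_series_algebra R n)"
    then have g: "g \<in> exponents n \<rightarrow>\<^sub>E carrier R" by (simp add: power_series_algebra_def)
    show "a \<odot>\<^bsub>power_series_algebra R n\<^esub> (f \<oplus>\<^bsub>power_series_algebra R n\<^esub> g) = a \<odot>\<^bsub>power_series_algebra R n\<^esub> f \<oplus>\<^bsub>power_series_algebra R n\<^esub> a \<odot>\<^bsub>power_series_algebra R n\<^esub> g"
      using cl power_series_coeff[OF g]
      by (auto simp: power_series_algebra_def intro!: restrict_ext r_distr)
  }
next
  fix f assume "f \<in> carrier (power_series_algebra R n)"
  then have f: "f \<in> exponents n \<rightarrow>\<^sub>E carrier R" by (simp add: power_series_algebra_def)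
  show "\<one> \<odot>\<^bsub>power_series_algebra R n\<^esub> f = f"
    unfolding power_series_algebra_def using f
    by (auto simp: PiE_iff intro!: extensionalityI[of _ "exponents n"])
qed

end

end

theory Submission
  imports Defs "HOL-Library.Countable_Set" "HOL-Library.Nat_Bijection"
begin

text \<open>The algebra is not even generated by a countable set, because its dimension as a vector space
  is uncountable.

  The products of finitely many elements of a countable set \<open>S\<close> form a countable set, and their
  span is already the algebra generated by \<open>S\<close> (\<open>generated_subalgebra_subset_submodule\<close>). So it is
  enough that no countable family \<open>g\<^sub>0, g\<^sub>1, \<dots>\<close> of power series spans all of them. The coefficients
  of the powers of one variable are split into disjoint blocks, the \<open>d\<close>-th of length \<open>d + 1\<close>. On
  this block there is a nonzero linear functional \<open>\<lambda>\<^sub>d\<close> that vanishes on the first \<open>d\<close> members of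
  the family: \<open>d\<close> homogeneous equations in \<open>d + 1\<close> unknowns have a nontrivial solution. Hence any
  element of the span is annihilated by \<open>\<lambda>\<^sub>d\<close> for all large \<open>d\<close>. Since the blocks are disjoint,
  the coefficients in each of them can be chosen independently, so some power series is annihilated
  by no \<open>\<lambda>\<^sub>d\<close> at all, and it lies outside the span.\<close>

section \<open>Subalgebras and spans of multiplicative sets\<close>

lemma (in module) submoduleI_smult:
  assumes "H \<subseteq> carrier M" and "\<zero>\<^bsub>M\<^esub> \<in> H"
    and "\<And>a b. a \<in> H \<Longrightarrow> b \<in> H \<Longrightarrow> a \<oplus>\<^bsub>M\<^esub> b \<in> H"
    and sm: "\<And>a x. a \<in> carrier R \<Longrightarrow> x \<in> H \<Longrightarrow> a \<odot>\<^bsub>M\<^esub> x \<in> H"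
  shows "submodule H R M"
proof (rule submoduleI)
  fix a assume a: "a \<in> H"
  then have "\<ominus>\<^bsub>M\<^esub> a = (\<ominus> \<one>) \<odot>\<^bsub>M\<^esub> a"
    using assms(1) smult_l_minus[of \<one> a] by auto
  then show "\<ominus>\<^bsub>M\<^esub> a \<in> H" using sm[OF _ a, of "\<ominus> \<one>"] by simp
qed (use assms in auto)

lemma submodule_zero: "submodule H R M \<Longrightarrow> \<zero>\<^bsub>M\<^esub> \<in> H"
  using subgroup.one_closed[OF submodule.axioms(1)] by fastforce

lemma (in module) submodule_Inter:
  assumes "\<And>H. H \<in> \<H> \<Longrightarrow> submodule H R M" and "\<H> \<noteq> {}"
  shows "submodule (\<Inter>\<H>) R M"
proof (rule submoduleI_smult)
  show "\<Inter>\<H> \<subseteq> carrier M" using assms submoduleE(1) by blast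
  show "\<zero>\<^bsub>M\<^esub> \<in> \<Inter>\<H>" using assms(1) submodule_zero by blast
  show "a \<oplus>\<^bsub>M\<^esub> b \<in> \<Inter>\<H>" if "a \<in> \<Inter>\<H>" "b \<in> \<Inter>\<H>" for a b
    using that submoduleE(5)[OF assms(1)] by blast
  show "a \<odot>\<^bsub>M\<^esub> x \<in> \<Inter>\<H>" if "a \<in> carrier R" "x \<in> \<Inter>\<H>" for a x
    using that submoduleE(4)[OF assms(1)] by blast
qed

lemma (in algebra) submodule_vimage_mult:
  assumes H: "submodule H R M" and b: "b \<in> carrier M"
  shows "submodule {a \<in> carrier M. a \<otimes>\<^bsub>M\<^esub> b \<in> H} R M"
proof (rule submoduleI_smult)
  show "\<zero>\<^bsub>M\<^esub> \<in> {a \<in> carrier M. a \<otimes>\<^bsub>M\<^esub> b \<in> H}"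
    using b submodule_zero[OF H] by simp
qed (use b submoduleE(4,5)[OF H] in \<open>auto simp: l_distr smult_assoc2\<close>)

text \<open>The span of a multiplicative set is a subring. For the closure under products, the elements
  that multiply the whole set into the span form a submodule, so they include the span; and for a
  fixed element of the span the same reasoning applies to the other factor.\<close>

lemma (in algebra) generated_subalgebra_subset_submodule:
  assumes W: "submonoid W M" and "S \<subseteq> W" and N: "submodule N R M" and "W \<subseteq> N"
  shows "generated_subalgebra R M S \<subseteq> N"
proof -
  define B where "B = \<Inter>{H. submodule H R M \<and> W \<subseteq> H}"
  have B: "submodule B R M"
    unfolding B_def by (rule submodule_Inter) (use N \<open>W \<subseteq> N\<close> in auto)
  have B_least: "B \<subseteq> H" if "submodule H R M" "W \<subseteq> H" for H
    using that unfolding B_def by blast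
  have WB: "W \<subseteq> B" unfolding B_def by blast
  note carr = subsetD[OF submoduleE(1)[OF B]] subsetD[OF submonoid.subset[OF W]]
  have *: "a \<otimes>\<^bsub>M\<^esub> w \<in> B" if "a \<in> B" "w \<in> W" for a w
  proof -
    have "B \<subseteq> {a \<in> carrier M. a \<otimes>\<^bsub>M\<^esub> w \<in> B}"
      by (rule B_least[OF submodule_vimage_mult[OF B carr(2)[OF that(2)]]])
        (use that WB carr submonoid.m_closed[OF W] in auto)
    then show ?thesis using that by blast
  qed
  have mult: "a \<otimes>\<^bsub>M\<^esub> b \<in> B" if "a \<in> B" "b \<in> B" for a b
  proof -
    have "B \<subseteq> {b \<in> carrier M. b \<otimes>\<^bsub>M\<^esub> a \<in> B}"
      by (rule B_least[OF submodule_vimage_mult[OF B carr(1)[OF that(1)]]])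
        (use that *[OF that(1)] carr m_comm in auto)
    then show ?thesis using that carr m_comm by auto
  qed
  have "subring B M"
    by (rule subringI)
      (use submoduleE(1,3,5)[OF B] mult submonoid.one_closed[OF W] WB in auto)
  then have "generated_subalgebra R M S \<subseteq> B"
    using B WB \<open>S \<subseteq> W\<close> unfolding generated_subalgebra_def by blast
  also have "B \<subseteq> N" by (rule B_least) fact+
  finally show ?thesis .
qed

text \<open>Such a submonoid consists of the products of words over \<open>S\<close>, and there are only countably many
  words.\<close>

lemma (in monoid) countable_submonoid_superset:
  assumes "countable S" and S: "S \<subseteq> carrier G"
  obtains W where "submonoid W G" and "countable W" and "S \<subseteq> W"
proof
  let ?p = "\<lambda>w. foldr (\<otimes>) w \<one>"
  have p: "?p w \<in> carrier G" if "w \<in> lists S" for w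
    using that by (induction w) (use S in auto)
  have app: "?p v \<otimes> ?p w = ?p (v @ w)" if "v \<in> lists S" "w \<in> lists S" for v w
    using that(1) by (induction v) (use S p[OF that(2)] p in \<open>auto simp: m_assoc subset_iff\<close>)
  show "submonoid (?p ` lists S) G"
  proof
    fix x y assume "x \<in> ?p ` lists S" "y \<in> ?p ` lists S"
    then obtain v w where "v \<in> lists S" "w \<in> lists S" "x = ?p v" "y = ?p w" by blast
    then show "x \<otimes> y \<in> ?p ` lists S"
      using app by (intro image_eqI[of _ _ "v @ w"]) auto
  next
    show "\<one> \<in> ?p ` lists S" by (rule image_eqI[of _ _ "[]"]) auto
  qed (use p in auto)
  show "countable (?p ` lists S)" using assms by simp
  show "S \<subseteq> ?p ` lists S"
  proof
    fix s assume "s \<in> S"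
    then show "s \<in> ?p ` lists S" using S by (intro image_eqI[of _ _ "[s]"]) auto
  qed
qed

section \<open>Homogeneous linear systems\<close>

text \<open>The unknowns range over a fixed set \<open>U\<close>, and the solution is supported in \<open>I\<close>, so that
  in the induction solutions with different supports can be combined. To satisfy one more equation,
  take two nontrivial solutions of the others, the second one vanishing at some point where the first
  does not. They are linearly independent, so some combination of them is nontrivial and solves the
  new equation as well.\<close>

lemma (in field) homogeneous_system_nontrivial_solution:
  fixes a :: "nat \<Rightarrow> 'i \<Rightarrow> 'a"
  assumes "finite U" and "I \<subseteq> U" and "d < card I"
    and "\<And>j i. j < d \<Longrightarrow> i \<in> U \<Longrightarrow> a j i \<in> carrier R"
  shows "\<exists>c\<in>U \<rightarrow> carrier R. (\<forall>i\<in>U - I. c i = \<zero>) \<and> (\<exists>i\<in>I. c i \<noteq> \<zero>) \<and>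
    (\<forall>j<d. (\<Oplus>i\<in>U. c i \<otimes> a j i) = \<zero>)"
  using assms(2-4)
proof (induction d arbitrary: I)
  case 0
  then have "I \<noteq> {}" by auto
  then show ?case
    by (intro bexI[of _ "\<lambda>i. if i \<in> I then \<one> else \<zero>"]) auto
next
  case (Suc d)
  obtain c where c: "c \<in> U \<rightarrow> carrier R" "\<forall>i\<in>U - I. c i = \<zero>" "\<exists>i\<in>I. c i \<noteq> \<zero>"
    "\<forall>j<d. (\<Oplus>i\<in>U. c i \<otimes> a j i) = \<zero>"
    using Suc.IH[of I] Suc.prems by auto
  obtain p where p: "p \<in> I" "c p \<noteq> \<zero>" using c(3) by blast
  have fin: "finite I" using Suc.prems(1) \<open>finite U\<close> finite_subset by blast
  have *: "I - {p} \<subseteq> U" "d < card (I - {p})"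
    using Suc.prems(1,2) fin p(1) by auto
  obtain c' where c': "c' \<in> U \<rightarrow> carrier R" "\<forall>i\<in>U - (I - {p}). c' i = \<zero>"
      "\<exists>i\<in>I - {p}. c' i \<noteq> \<zero>" "\<forall>j<d. (\<Oplus>i\<in>U. c' i \<otimes> a j i) = \<zero>"
    using Suc.IH[OF *] Suc.prems(3) by auto
  define s where "s = (\<Oplus>i\<in>U. c i \<otimes> a d i)"
  define s' where "s' = (\<Oplus>i\<in>U. c' i \<otimes> a d i)"
  have s: "s \<in> carrier R" "s' \<in> carrier R"
    unfolding s_def s'_def using c(1) c'(1) Suc.prems(3) by (auto intro!: finsum_closed)
  show ?case
  proof (cases "s' = \<zero>")
    case True
    then show ?thesis
      using c' by (intro bexI[of _ c']) (auto simp: s'_def less_Suc_eq)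
  next
    case False
    \<comment> \<open>The new equation takes the values \<open>s\<close> and \<open>s'\<close> on \<open>c\<close> and \<open>c'\<close>, which cancel in \<open>?e\<close>; at \<open>p\<close>
      only \<open>c\<close> contributes.\<close>
    let ?e = "\<lambda>i. s' \<otimes> c i \<oplus> (\<ominus> s) \<otimes> c' i"
    have lin: "(\<Oplus>i\<in>U. ?e i \<otimes> a j i)
        = s' \<otimes> (\<Oplus>i\<in>U. c i \<otimes> a j i) \<oplus> (\<ominus> s) \<otimes> (\<Oplus>i\<in>U. c' i \<otimes> a j i)" if "j < Suc d" for j
    proof -
      have cl: "c i \<in> carrier R" "c' i \<in> carrier R" "a j i \<in> carrier R" if "i \<in> U" for i
        using c(1) c'(1) Suc.prems(3) \<open>j < Suc d\<close> that by auto
      have "(\<Oplus>i\<in>U. ?e i \<otimes> a j i)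
          = (\<Oplus>i\<in>U. s' \<otimes> (c i \<otimes> a j i) \<oplus> (\<ominus> s) \<otimes> (c' i \<otimes> a j i))"
        by (rule finsum_cong') (use s cl in \<open>auto simp: l_distr m_assoc\<close>)
      also have "\<dots> = (\<Oplus>i\<in>U. s' \<otimes> (c i \<otimes> a j i)) \<oplus> (\<Oplus>i\<in>U. (\<ominus> s) \<otimes> (c' i \<otimes> a j i))"
        by (rule finsum_addf) (use s cl in auto)
      also have "\<dots> = s' \<otimes> (\<Oplus>i\<in>U. c i \<otimes> a j i) \<oplus> (\<ominus> s) \<otimes> (\<Oplus>i\<in>U. c' i \<otimes> a j i)"
        using s cl \<open>finite U\<close>
          finsum_rdistr[of U s' "\<lambda>i. c i \<otimes> a j i"]
          finsum_rdistr[of U "\<ominus> s" "\<lambda>i. c' i \<otimes> a j i"] by auto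
      finally show ?thesis .
    qed
    have pU: "p \<in> U" using p(1) Suc.prems(1) by blast
    then have cp: "c p \<in> carrier R" using c(1) by blast
    have "?e p = s' \<otimes> c p"
      using c'(2) pU s cp by simp
    then have "?e p \<noteq> \<zero>"
      using False p(2) integral_iff[of s' "c p"] s cp by simp
    moreover have "(\<Oplus>i\<in>U. ?e i \<otimes> a d i) = \<zero>"
      using lin[of d] s by (simp add: s_def[symmetric] s'_def[symmetric] m_comm[of s'] l_minus r_neg)
    moreover have "(\<Oplus>i\<in>U. ?e i \<otimes> a j i) = \<zero>" if "j < d" for j
      using lin[of j] that c(4) c'(4) s by simp
    moreover have "?e \<in> U \<rightarrow> carrier R"
      using c(1) c'(1) s by (simp add: Pi_iff)
    moreover have "\<forall>i\<in>U - I. ?e i = \<zero>"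
      using c(2) c'(2) s by simp
    ultimately show ?thesis
      using p(1) by (intro bexI[of _ ?e]) (auto simp: less_Suc_eq)
  qed
qed

text \<open>The diagonal argument: \<open>c d\<close> is the functional on the \<open>d\<close>-th block. The conclusion says
  that \<open>f\<close> is not a linear combination of the \<open>g j\<close>: almost all of the functionals annihilate a given
  combination, but none of them annihilates \<open>f\<close>. On block \<open>d\<close> it is enough to let \<open>f\<close> be \<open>\<one>\<close> at one place where
  \<open>c d\<close> does not vanish and \<open>\<zero>\<close> elsewhere.\<close>

lemma (in field) block_functionals_separating_from_countable_family:
  fixes g :: "nat \<Rightarrow> nat \<Rightarrow> nat \<Rightarrow> 'a"
  assumes g: "\<And>j d i. g j d i \<in> carrier R"
  shows "\<exists>c f. (\<forall>d. \<forall>i\<le>d. c d i \<in> carrier R) \<and> (\<forall>d i. f d i \<in> carrier R) \<and>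
    (\<forall>d. \<forall>j<d. (\<Oplus>i\<in>{..d}. c d i \<otimes> g j d i) = \<zero>) \<and>
    (\<forall>d. (\<Oplus>i\<in>{..d}. c d i \<otimes> f d i) \<noteq> \<zero>)"
proof -
  have "\<exists>c. c \<in> {..d} \<rightarrow> carrier R \<and> (\<exists>i\<le>d. c i \<noteq> \<zero>) \<and>
      (\<forall>j<d. (\<Oplus>i\<in>{..d}. c i \<otimes> g j d i) = \<zero>)" for d
    using homogeneous_system_nontrivial_solution[of "{..d}" "{..d}" d "\<lambda>j. g j d"] g by auto
  then obtain c where c: "\<And>d. c d \<in> {..d} \<rightarrow> carrier R" "\<And>d. \<exists>i\<le>d. c d i \<noteq> \<zero>"
      "\<And>d. \<forall>j<d. (\<Oplus>i\<in>{..d}. c d i \<otimes> g j d i) = \<zero>"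
    by metis
  obtain p where p: "\<And>d. p d \<le> d" "\<And>d. c d (p d) \<noteq> \<zero>" using c(2) by metis
  define f where "f d i = (if p d = i then \<one> else \<zero>)" for d i
  have "(\<Oplus>i\<in>{..d}. c d i \<otimes> f d i) = c d (p d)" for d
  proof -
    have cd: "c d i \<in> carrier R" if "i \<le> d" for i using c(1)[of d] that by auto
    have "(\<Oplus>i\<in>{..d}. c d i \<otimes> f d i) = (\<Oplus>i\<in>{..d}. if p d = i then c d i else \<zero>)"
      by (rule finsum_cong') (use cd in \<open>auto simp: f_def\<close>)
    also have "\<dots> = c d (p d)"
      by (rule finsum_singleton) (use p cd in auto)
    finally show ?thesis .
  qed
  then show ?thesis
    using c p by (intro exI[of _ c] exI[of _ f]) (auto simp: f_def Pi_iff)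
qed

section \<open>Power series\<close>

lemma (in field) power_series_algebra_not_countably_generated:
  assumes "n \<ge> 1" and "countable S" and S: "S \<subseteq> carrier (power_series_algebra R n)"
  shows "generated_subalgebra R (power_series_algebra R n) S \<noteq> carrier (power_series_algebra R n)"
proof -
  let ?A = "power_series_algebra R n"
  interpret A: algebra R ?A by (rule power_series_is_algebra)
  have carrier_A: "carrier ?A = exponents n \<rightarrow>\<^sub>E carrier R"
    by (simp add: power_series_algebra_def)
  obtain W where W: "submonoid W ?A" "countable W" "S \<subseteq> W"
    using A.countable_submonoid_superset[OF assms(2,3)] by metis
  \<comment> \<open>The pairing function keeps the blocks disjoint: \<open>x d i\<close> is the exponent vector of the \<open>i\<close>-th
    monomial, a power of the first variable, in block \<open>d\<close>.\<close>
  define x where "x d i = (\<lambda>k::nat. if k = 0 then prod_encode (d, i) else 0)" for d i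
  have x: "x d i \<in> exponents n" for d i
    using \<open>n \<ge> 1\<close> by (auto simp: x_def exponents_def)
  have coeff: "h (x d i) \<in> carrier R" if "h \<in> carrier ?A" for h d i
    using that x carrier_A by auto
  have ran: "from_nat_into W j \<in> carrier ?A" for j
    using from_nat_into[of W j] submonoid.one_closed[OF W(1)] submonoid.subset[OF W(1)] by blast
  obtain c f where cf: "\<forall>d. \<forall>i\<le>d. c d i \<in> carrier R" "\<forall>d i. f d i \<in> carrier R"
    "\<forall>d. \<forall>j<d. (\<Oplus>i\<in>{..d}. c d i \<otimes> from_nat_into W j (x d i)) = \<zero>"
    "\<forall>d. (\<Oplus>i\<in>{..d}. c d i \<otimes> f d i) \<noteq> \<zero>"
    using block_functionals_separating_from_countable_family
        [of "\<lambda>j d i. from_nat_into W j (x d i)", OF coeff[OF ran]]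
    by (elim exE conjE)
  have c: "c d i \<in> carrier R" if "i \<le> d" for d i using cf(1) that by blast
  define l where "l d h = (\<Oplus>i\<in>{..d}. c d i \<otimes> h (x d i))" for d h
  \<comment> \<open>The annihilation condition depends on large \<open>d\<close> only, so every element of the enumerated set \<open>W\<close>
    satisfies it, although finitely many of the functionals may fail to annihilate it.\<close>
  define N where "N = {h \<in> carrier ?A. \<forall>\<^sub>F d in sequentially. l d h = \<zero>}"
  have "submodule N R ?A"
  proof (rule A.submoduleI_smult)
    have "l d \<zero>\<^bsub>?A\<^esub> = \<zero>" for d
    proof -
      have "l d \<zero>\<^bsub>?A\<^esub> = (\<Oplus>i\<in>{..d}. \<zero>)"
        unfolding l_def
        by (rule finsum_cong') (use c x in \<open>auto simp: power_series_algebra_def\<close>)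
      then show ?thesis by simp
    qed
    then show "\<zero>\<^bsub>?A\<^esub> \<in> N" by (simp add: N_def)
  next
    fix g h assume gh: "g \<in> N" "h \<in> N"
    then have carr: "g \<in> carrier ?A" "h \<in> carrier ?A" by (auto simp: N_def)
    have "l d (g \<oplus>\<^bsub>?A\<^esub> h) = l d g \<oplus> l d h" for d
    proof -
      have "l d (g \<oplus>\<^bsub>?A\<^esub> h) = (\<Oplus>i\<in>{..d}. c d i \<otimes> g (x d i) \<oplus> c d i \<otimes> h (x d i))"
        unfolding l_def
        by (rule finsum_cong')
          (use c x coeff carr in \<open>auto simp: power_series_algebra_def r_distr\<close>)
      also have "\<dots> = l d g \<oplus> l d h"
        unfolding l_def by (rule finsum_addf) (use c coeff carr in auto)
      finally show ?thesis .
    qed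
    then show "g \<oplus>\<^bsub>?A\<^esub> h \<in> N"
      using gh by (auto simp: N_def elim: eventually_elim2)
  next
    fix b h assume b: "b \<in> carrier R" and h: "h \<in> N"
    then have carr: "h \<in> carrier ?A" by (auto simp: N_def)
    have "l d (b \<odot>\<^bsub>?A\<^esub> h) = b \<otimes> l d h" for d
    proof -
      have "l d (b \<odot>\<^bsub>?A\<^esub> h) = (\<Oplus>i\<in>{..d}. b \<otimes> (c d i \<otimes> h (x d i)))"
        unfolding l_def
        by (rule finsum_cong')
          (use b c x coeff carr in \<open>auto simp: power_series_algebra_def m_lcomm\<close>)
      also have "\<dots> = b \<otimes> l d h"
        unfolding l_def by (rule finsum_rdistr[symmetric]) (use b c coeff carr in auto)
      finally show ?thesis .
    qed
    then show "b \<odot>\<^bsub>?A\<^esub> h \<in> N"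
      using h b by (auto simp: N_def elim: eventually_mono)
  qed (auto simp: N_def)
  moreover have "W \<subseteq> N"
  proof
    fix w assume "w \<in> W"
    then obtain j where j: "w = from_nat_into W j"
      using subset_range_from_nat_into[OF W(2)] by blast
    have "\<forall>\<^sub>F d in sequentially. l d w = \<zero>"
      using eventually_gt_at_top[of j] by eventually_elim (simp add: l_def j cf(3))
    then show "w \<in> N" using ran j by (simp add: N_def)
  qed
  ultimately have gen: "generated_subalgebra R ?A S \<subseteq> N"
    by (rule A.generated_subalgebra_subset_submodule[OF W(1,3)])
  let ?F = "\<lambda>m\<in>exponents n. case prod_decode (m 0) of (d, i) \<Rightarrow> f d i"
  have "?F \<in> carrier ?A" using cf(2) by (auto simp: carrier_A split: prod.split)
  moreover have "l d ?F \<noteq> \<zero>" for d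
    using cf(4) x by (simp add: l_def x_def)
  then have "?F \<notin> N" by (simp add: N_def)
  ultimately show ?thesis using gen by blast
qed

theorem proposition3:
  fixes K :: "('a, 'b) ring_scheme" and n :: nat
  assumes "field K" and "n \<ge> 1"
  shows "\<not> finitely_generated_algebra K (power_series_algebra K n)"
  using field.power_series_algebra_not_countably_generated[OF assms countable_finite]
  by (auto simp: finitely_generated_algebra_def)

end
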